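(* Let $\mathcal{S}$ be either an Ulam set or a $\mathcal{V}$-set in $\mathbb{Z}^2$, with generators in $\mathbb{Z}_{\ge 0}^2\setminus\{(0,0)\}$, for which the column $x=0$ is eventually periodic. Then all the columns of $\mathcal{S}$ are eventually periodic.
   Context: Let $S\subset\mathbb{Z}_{\ge 0}^2\setminus\{(0,0)\}$ be a finite initial set of generators; the size of $(x,y)$ may be taken to be $x+y$. The Ulam set $\mathcal{U}(S)$ is built by first putting in the elements of $S$ and then repeatedly adding a smallest element not already in the set that is uniquely represented as the sum of two distinct elements already in the set (with $p+q$ and $q+p$ the same representation); ties may be broken arbitrarily without affecting the resulting set. The $\mathcal{V}$-set $\mathcal{V}(S)$ is defined in the same way except that the two summands are not required to be distinct. Equivalently, an element not in $S$ is in the set iff it equals $p+q$ for exactly one unordered pair of elements $p,q$ of the set, with $p\ne q$ required in the Ulam case and $p=q$ allowed in the $\mathcal{V}$-set case. For a subset $\mathcal{S}\subset\mathbb{Z}_{\ge 0}^2$ and a fixed $x\ge 0$, the $x$-column of $\mathcal{S}$ is eventually periodic if there is a period $p>0$ such that, for all sufficiently large $y$, $(x,y)\in \mathcal{S}$ if and only if $(x,y+p)\in \mathcal{S}$. *)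

theory Defs
  imports Main "HOL-Library.Product_Plus"
begin

text \<open>
  The lattice quadrant of pairs of nonnegative integers is \<open>nat \<times> nat\<close>, with componentwise
  addition. The relation \<open>R\<close> below says which pairs of summands are allowed: it is \<open>(\<noteq>)\<close> for
  Ulam sets and the full relation for V-sets.
\<close>

definition size2 :: "nat \<times> nat \<Rightarrow> nat" where
  "size2 z = fst z + snd z"

text \<open>
  A representation is an unordered pair of summands, encoded as the set \<open>{p, q}\<close>, which is
  \<open>{p}\<close> if \<open>p = q\<close>.
\<close>

definition reps ::
  "(nat \<times> nat \<Rightarrow> nat \<times> nat \<Rightarrow> bool) \<Rightarrow> (nat \<times> nat) set \<Rightarrow> nat \<times> nat \<Rightarrow> (nat \<times> nat) set set" where
  "reps R A z = {{p, q} | p q. p \<in> A \<and> q \<in> A \<and> R p q \<and> p + q = z}"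

definition candidates ::
  "(nat \<times> nat \<Rightarrow> nat \<times> nat \<Rightarrow> bool) \<Rightarrow> (nat \<times> nat) set \<Rightarrow> (nat \<times> nat) set" where
  "candidates R A = {z. z \<notin> A \<and> (\<exists>!P. P \<in> reps R A z)}"

text \<open>
  \<open>generated R S U\<close>: some run of the greedy construction, started from \<open>S\<close> and with
  ties broken arbitrarily, produces \<open>U\<close>. A run that has no element left to add stays constant.
\<close>

definition generated ::
  "(nat \<times> nat \<Rightarrow> nat \<times> nat \<Rightarrow> bool) \<Rightarrow> (nat \<times> nat) set \<Rightarrow> (nat \<times> nat) set \<Rightarrow> bool" where
  "generated R S U \<longleftrightarrow>
    (\<exists>A :: nat \<Rightarrow> (nat \<times> nat) set.
       A 0 = S \<and>
       (\<forall>n. if candidates R (A n) = {} then A (Suc n) = A n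
            else \<exists>z. is_arg_min size2 (\<lambda>w. w \<in> candidates R (A n)) z \<and>
                     A (Suc n) = insert z (A n)) \<and>
       U = (\<Union>n. A n))"

definition ulam_set :: "(nat \<times> nat) set \<Rightarrow> (nat \<times> nat) set \<Rightarrow> bool" where
  "ulam_set S U \<longleftrightarrow> generated (\<noteq>) S U"

definition V_set :: "(nat \<times> nat) set \<Rightarrow> (nat \<times> nat) set \<Rightarrow> bool" where
  "V_set S U \<longleftrightarrow> generated (\<lambda>p q. True) S U"

definition column_eventually_periodic :: "(nat \<times> nat) set \<Rightarrow> nat \<Rightarrow> bool" where
  "column_eventually_periodic U x \<longleftrightarrow>
    (\<exists>p>0. \<exists>Y. \<forall>y\<ge>Y. (x, y) \<in> U \<longleftrightarrow> (x, y + p) \<in> U)"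

end

theory Submission
  imports Defs
begin

text \<open>
  Ulam sets and V-sets are treated together. The greedy construction never revisits smaller sizes,
  so its result \<open>U\<close> obeys a recursion: outside \<open>S\<close>, membership means having exactly one
  representation in \<open>U\<close> (\<open>generated_iff_unique_rep\<close>).

  Assume that the columns left of column \<open>x > 0\<close> are periodic with common period \<open>P\<close> above height
  \<open>Y\<close>. Call a representation of \<open>(x, y)\<close> low if one summand is \<open>(0, b)\<close> with \<open>b < Y\<close>. A
  representation that is not low always has a summand in a column left of \<open>x\<close> at height at least
  \<open>Y\<close>, once \<open>y \<ge> 2 * Y\<close>. Raising this summand by \<open>P\<close> gives a representation of \<open>(x, y + P)\<close>,
  and the choice can be made injectively. So the number of representations that are not low is
  nondecreasing along each residue class modulo \<open>P\<close>; capped at \<open>2\<close>, which loses nothing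
  when asking whether the total is \<open>1\<close>, it becomes periodic
  (\<open>bounded_mono_shift_eventually_periodic\<close>).

  The low representations of \<open>(x, y)\<close> depend only on which of the points \<open>(x, y - b)\<close> with
  \<open>1 \<le> b < Y\<close> lie in \<open>U\<close>. Hence, high up, column \<open>x\<close> is the output of a machine with finitely
  many states and periodic input, and such an output is eventually periodic by the pigeonhole
  principle (\<open>window_recursion_eventually_periodic\<close>). Induction on \<open>x\<close> finishes the proof.
\<close>

section \<open>The recursion satisfied by a greedily generated set\<close>

lemma size2_add: "size2 (p + q) = size2 p + size2 q"
  by (simp add: size2_def)

lemma size2_pos: "z \<noteq> (0, 0) \<Longrightarrow> 0 < size2 z"
  by (cases z) (auto simp: size2_def)

lemma finite_size2_le: "finite {w. size2 w \<le> s}"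
proof (rule finite_subset)
  show "{w. size2 w \<le> s} \<subseteq> {..s} \<times> {..s}" by (auto simp: size2_def)
qed simp

lemma repsI: "p \<in> A \<Longrightarrow> q \<in> A \<Longrightarrow> R p q \<Longrightarrow> p + q = z \<Longrightarrow> {p, q} \<in> reps R A z"
  unfolding reps_def by blast

lemma repsE:
  assumes "T \<in> reps R A z"
  obtains p q where "T = {p, q}" "p \<in> A" "q \<in> A" "R p q" "p + q = z"
  using assms unfolding reps_def by blast

lemma reps_mono: "A \<subseteq> B \<Longrightarrow> reps R A z \<subseteq> reps R B z"
  unfolding reps_def by blast

text \<open>
  A point that becomes a candidate only through the insertion of \<open>z\<close> has \<open>z\<close> as a summand, so it is
  at least as large as \<open>z\<close>. This is why the greedy construction never goes back to smaller sizes.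
\<close>

lemma candidates_insert_size_ge:
  assumes ge: "\<forall>w\<in>candidates R A. s \<le> size2 w" and z: "s \<le> size2 z"
  shows "\<forall>w\<in>candidates R (insert z A). s \<le> size2 w"
proof
  fix w assume w: "w \<in> candidates R (insert z A)"
  then obtain T where T: "T \<in> reps R (insert z A) w"
    and uniq: "\<And>T'. T' \<in> reps R (insert z A) w \<Longrightarrow> T' = T"
    unfolding candidates_def by blast
  show "s \<le> size2 w"
  proof (cases "T \<in> reps R A w")
    case True
    have "w \<in> candidates R A"
      using w True uniq reps_mono[of A "insert z A" R w] unfolding candidates_def by blast
    then show ?thesis using ge by blast
  next
    case False
    obtain p q where pq: "T = {p, q}" "p \<in> insert z A" "q \<in> insert z A" "R p q" "p + q = w"
      using T by (rule repsE)
    have "p = z \<or> q = z" using pq False repsI[of p A q R w] by blast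
    then show ?thesis using z pq(5) size2_add[of p q] by auto
  qed
qed

lemma generated_zero_notin:
  assumes "generated R S U" "(0, 0) \<notin> S"
  shows "(0, 0) \<notin> U"
proof -
  obtain A where A0: "A 0 = S" and U: "U = (\<Union>n. A n)"
    and step: "\<And>n. if candidates R (A n) = {} then A (Suc n) = A n
            else \<exists>z. is_arg_min size2 (\<lambda>w. w \<in> candidates R (A n)) z \<and>
                     A (Suc n) = insert z (A n)"
    using assms(1) unfolding generated_def by blast
  have "(0, 0) \<notin> A n" for n
  proof (induction n)
    case 0 then show ?case using A0 assms(2) by simp
  next
    case (Suc n)
    have "(0, 0) \<notin> candidates R (A n)"
    proof
      assume "(0, 0) \<in> candidates R (A n)"
      then obtain T where "T \<in> reps R (A n) (0, 0)" unfolding candidates_def by blast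
      then obtain p q where "p \<in> A n" "p + q = (0, 0)" by (rule repsE)
      then show False using Suc.IH by (cases p, cases q) auto
    qed
    then show ?case using step[of n] Suc.IH by (auto simp: is_arg_min_def split: if_splits)
  qed
  then show ?thesis using U by blast
qed

text \<open>
  When \<open>z\<close> is inserted, all smaller members of \<open>U\<close> are already present, and only these can be summands
  of \<open>z\<close>, so its representations never change afterwards. Conversely, a point with a unique
  representation in \<open>U\<close> would, if never inserted, stay a candidate from some step on, although only
  finitely many points can be preferred to it.
\<close>

theorem generated_iff_unique_rep:
  assumes gen: "generated R S U" and S0: "(0, 0) \<notin> S" and zS: "z \<notin> S"
  shows "z \<in> U \<longleftrightarrow> (\<exists>!T. T \<in> reps R U z)"
proof -
  obtain A where A0: "A 0 = S" and U: "U = (\<Union>n. A n)"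
    and step: "\<And>n. if candidates R (A n) = {} then A (Suc n) = A n
            else \<exists>z. is_arg_min size2 (\<lambda>w. w \<in> candidates R (A n)) z \<and>
                     A (Suc n) = insert z (A n)"
    using gen unfolding generated_def by blast
  have A_cases: "candidates R (A n) = {} \<and> A (Suc n) = A n \<or>
      (\<exists>w. w \<in> candidates R (A n) \<and> (\<forall>v\<in>candidates R (A n). size2 w \<le> size2 v) \<and>
           A (Suc n) = insert w (A n))" for n
  proof (cases "candidates R (A n) = {}")
    case False
    then obtain w where w: "is_arg_min size2 (\<lambda>v. v \<in> candidates R (A n)) w"
        "A (Suc n) = insert w (A n)"
      using step[of n] by auto
    then show ?thesis unfolding is_arg_min_linorder by blast
  qed (use step[of n] in simp)
  have sub: "A n \<subseteq> A m" if "n \<le> m" for n m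
  proof (rule lift_Suc_mono_le[OF _ that])
    fix k
    show "A k \<subseteq> A (Suc k)" using A_cases[of k] by blast
  qed
  have A_U: "A n \<subseteq> U" for n using U by blast
  have zero: "(0, 0) \<notin> U" using generated_zero_notin[OF gen S0] .
  show ?thesis
  proof
    assume "z \<in> U"
    then obtain m where "z \<in> A m" using U by blast
    moreover have "z \<notin> A 0" using zS A0 by simp
    ultimately obtain k where k: "z \<notin> A k" "z \<in> A (Suc k)"
      using ex_least_nat_less[of "\<lambda>n. z \<in> A n" m] by blast
    have zc: "z \<in> candidates R (A k)"
      and zmin: "\<forall>v\<in>candidates R (A k). size2 z \<le> size2 v"
      using A_cases[of k] k by auto
    have late: "(\<forall>w\<in>candidates R (A m). size2 z \<le> size2 w) \<and>
        A m \<subseteq> A k \<union> {w. size2 z \<le> size2 w}" if "k \<le> m" for m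
      using that
    proof (induction m rule: dec_induct)
      case base then show ?case using zmin by blast
    next
      case (step m)
      then show ?case using A_cases[of m] candidates_insert_size_ge[of R "A m" "size2 z"] by auto
    qed
    have small: "w \<in> A k" if w: "w \<in> U" "size2 w < size2 z" for w
    proof -
      obtain m where "w \<in> A m" using w U by blast
      then have "w \<in> A (max k m)" using sub[of m "max k m"] by auto
      then show ?thesis using late[of "max k m"] w(2) by auto
    qed
    have "reps R U z \<subseteq> reps R (A k) z"
    proof
      fix T assume "T \<in> reps R U z"
      then obtain p q where pq: "T = {p, q}" "p \<in> U" "q \<in> U" "R p q" "p + q = z"
        by (rule repsE)
      have "0 < size2 p" "0 < size2 q" using pq zero size2_pos by metis+
      then have "p \<in> A k" "q \<in> A k" using small pq size2_add[of p q] by auto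
      then show "T \<in> reps R (A k) z" using pq repsI by blast
    qed
    then have "reps R U z = reps R (A k) z" using reps_mono[OF A_U] by blast
    then show "\<exists>!T. T \<in> reps R U z" using zc unfolding candidates_def by simp
  next
    assume ex1: "\<exists>!T. T \<in> reps R U z"
    then obtain T where T: "T \<in> reps R U z" by blast
    then obtain p q where pq: "T = {p, q}" "p \<in> U" "q \<in> U" "R p q" "p + q = z"
      by (rule repsE)
    then obtain i j where "p \<in> A i" "q \<in> A j" using U by blast
    then have pqn: "p \<in> A (max i j)" "q \<in> A (max i j)"
      using sub[of i "max i j"] sub[of j "max i j"] by auto
    define n where "n = max i j"
    show "z \<in> U"
    proof (rule ccontr)
      assume zU: "z \<notin> U"
      have cand: "z \<in> candidates R (A m)" if "n \<le> m" for m
      proof -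
        have "p \<in> A m" "q \<in> A m" using pqn sub[OF that] unfolding n_def by auto
        then have "T \<in> reps R (A m) z" using pq repsI by blast
        then show ?thesis
          using zU A_U ex1 reps_mono[OF A_U, of R m z] unfolding candidates_def by blast
      qed
      \<comment> \<open>While \<open>z\<close> waits, every step adds a new point of size at most \<open>size2 z\<close>, and there are only
        finitely many of those.\<close>
      define B where "B m = A m \<inter> {w. size2 w \<le> size2 z}" for m
      have finB: "finite (B m)" for m unfolding B_def using finite_size2_le by simp
      have grow: "k \<le> card (B (n + k))" for k
      proof (induction k)
        case (Suc k)
        obtain w where w: "w \<in> candidates R (A (n + k))" "size2 w \<le> size2 z"
            "A (Suc (n + k)) = insert w (A (n + k))"
          using A_cases[of "n + k"] cand[of "n + k"] by auto
        have "w \<notin> B (n + k)" using w(1) unfolding B_def candidates_def by simp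
        moreover have "B (Suc (n + k)) = insert w (B (n + k))" using w unfolding B_def by auto
        ultimately show ?case using Suc.IH finB by simp
      qed simp
      let ?N = "card {w. size2 w \<le> size2 z}"
      have "card (B (n + Suc ?N)) \<le> ?N"
        unfolding B_def by (intro card_mono finite_size2_le) simp
      then show False using grow[of "Suc ?N"] by simp
    qed
  qed
qed

section \<open>Eventually periodic sequences\<close>

lemma bounded_mono_shift_eventually_periodic:
  fixes h :: "nat \<Rightarrow> nat"
  assumes mono: "\<And>y. N \<le> y \<Longrightarrow> h y \<le> h (y + P)" and bd: "\<And>y. h y \<le> B"
  shows "\<exists>M. \<forall>y\<ge>M. h (y + P) = h y"
proof (cases "P = 0")
  case False
  have const: "\<exists>K. \<forall>k\<ge>K. h (N + r + k * P) = h (N + r + K * P)" for r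
  proof -
    let ?g = "\<lambda>k. h (N + r + k * P)"
    have inc: "?g i \<le> ?g j" if "i \<le> j" for i j
    proof (rule lift_Suc_mono_le[OF _ that])
      fix k
      show "?g k \<le> ?g (Suc k)" using mono[of "N + r + k * P"] by (simp add: algebra_simps)
    qed
    have fin: "finite (range ?g)"
      using bd by (intro finite_subset[of "range ?g" "{..B}"]) auto
    obtain K where K: "?g K = Max (range ?g)" using Max_in[OF fin] by auto
    have "?g k = ?g K" if "K \<le> k" for k
      using inc[OF that] Max_ge[OF fin, of "?g k"] K by simp
    then show ?thesis by blast
  qed
  then obtain K where K: "\<And>r k. K r \<le> k \<Longrightarrow> h (N + r + k * P) = h (N + r + K r * P)"
    by metis
  define L where "L = Max (K ` {..<P})"
  have "h (y + P) = h y" if y: "N + L * P + P \<le> y" for y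
  proof -
    define r k where "r = (y - N) mod P" and "k = (y - N) div P"
    have yrk: "y = N + r + k * P" using y unfolding r_def k_def by simp
    have "r < P" using False unfolding r_def by simp
    then have "K r \<le> L" unfolding L_def by (intro Max_ge) auto
    moreover have "L \<le> k"
      unfolding k_def using False y by (simp add: less_eq_div_iff_mult_less_eq)
    ultimately show ?thesis
      using K[of r k] K[of r "Suc k"] yrk by (simp add: add_ac)
  qed
  then show ?thesis by blast
qed simp

text \<open>
  A sequence over two letters whose next term depends on its last \<open>L\<close> terms and on a periodic input
  \<open>c\<close>: two equal windows at positions congruent modulo \<open>P\<close> exist by the pigeonhole principle, and from
  there on the two continuations agree. That \<open>u y\<close> is a function of the input and of the window is
  expressed by comparing two positions.
\<close>

lemma window_recursion_eventually_periodic: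
  fixes u :: "nat \<Rightarrow> bool" and c :: "nat \<Rightarrow> 'a"
  assumes P: "0 < P" and c: "\<And>y. N \<le> y \<Longrightarrow> c (y + P) = c y" and NL: "L \<le> N"
    and det: "\<And>y y'. N \<le> y \<Longrightarrow> N \<le> y' \<Longrightarrow> c y = c y' \<Longrightarrow>
      (\<And>i. 1 \<le> i \<Longrightarrow> i \<le> L \<Longrightarrow> u (y - i) = u (y' - i)) \<Longrightarrow> u y = u y'"
  shows "\<exists>p>0. \<exists>M. \<forall>y\<ge>M. u y = u (y + p)"
proof -
  let ?s = "\<lambda>k. {i \<in> {1..L}. u (N + k * P - i)}"
  have "finite (range ?s)" by (rule finite_subset[of _ "Pow {1..L}"]) auto
  then have "\<not> inj ?s" using finite_imageD[of ?s UNIV] by auto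
  then obtain i j where ij: "i < j" "?s i = ?s j"
    unfolding inj_def by (metis linorder_neqE_nat)
  define p where "p = (j - i) * P"
  have jP: "j * P = i * P + p" using ij(1) unfolding p_def by (simp flip: add_mult_distrib)
  have cp: "c (y + p) = c y" if "N \<le> y" for y
  proof -
    have "c (y + k * P) = c y" for k
    proof (induction k)
      case (Suc k)
      then show ?case using c[of "y + k * P"] that by (simp add: add_ac)
    qed simp
    then show ?thesis unfolding p_def .
  qed
  have agree: "u (N + i * P - L + t) = u (N + i * P - L + t + p)" for t
  proof (induction t rule: less_induct)
    case (less t)
    show ?case
    proof (cases "t < L")
      case True
      have "L - t \<in> ?s i \<longleftrightarrow> L - t \<in> ?s j" using ij(2) by simp
      then have "u (N + i * P - (L - t)) = u (N + j * P - (L - t))" using True by auto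
      moreover have "N + i * P - (L - t) = N + i * P - L + t" using True NL by simp
      moreover have "N + j * P - (L - t) = N + i * P - L + t + p" using True NL jP by simp
      ultimately show ?thesis by simp
    next
      case False
      let ?y = "N + i * P - L + t"
      have y: "N \<le> ?y" using False NL by simp
      show ?thesis
      proof (rule det)
        fix b assume b: "1 \<le> b" "b \<le> L"
        have "u (N + i * P - L + (t - b)) = u (N + i * P - L + (t - b) + p)"
          using less.IH[of "t - b"] b False by simp
        moreover have "N + i * P - L + (t - b) = ?y - b" using b False by simp
        moreover have "?y - b + p = ?y + p - b" using b False by simp
        ultimately show "u (?y - b) = u (?y + p - b)" by simp
      qed (use y cp in auto)
    qed
  qed
  have "u y = u (y + p)" if "N + i * P - L \<le> y" for y
    using agree[of "y - (N + i * P - L)"] that by simp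
  moreover have "0 < p" using ij(1) P unfolding p_def by simp
  ultimately show ?thesis by blast
qed

lemma common_period:
  assumes "\<forall>i<n. column_eventually_periodic U i"
  shows "\<exists>P>0. \<exists>Y. \<forall>i<n. \<forall>y\<ge>Y. (i, y) \<in> U \<longleftrightarrow> (i, y + P) \<in> U"
  using assms
proof (induction n)
  case (Suc n)
  have "\<forall>i<n. column_eventually_periodic U i" using Suc.prems by simp
  then obtain P Y where P: "0 < P"
    and PY: "\<And>i y. i < n \<Longrightarrow> Y \<le> y \<Longrightarrow> (i, y) \<in> U \<longleftrightarrow> (i, y + P) \<in> U"
    using Suc.IH by blast
  obtain P' Y' where P': "0 < P'"
    and PY': "\<And>y. Y' \<le> y \<Longrightarrow> (n, y) \<in> U \<longleftrightarrow> (n, y + P') \<in> U"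
    using Suc.prems unfolding column_eventually_periodic_def by blast
  have m1: "(i, y) \<in> U \<longleftrightarrow> (i, y + k * P) \<in> U" if "i < n" "Y \<le> y" for i y k
  proof (induction k)
    case (Suc k)
    then show ?case using PY[of i "y + k * P"] that by (simp add: add_ac)
  qed simp
  have m2: "(n, y) \<in> U \<longleftrightarrow> (n, y + k * P') \<in> U" if "Y' \<le> y" for y k
  proof (induction k)
    case (Suc k)
    then show ?case using PY'[of "y + k * P'"] that by (simp add: add_ac)
  qed simp
  have "(i, y) \<in> U \<longleftrightarrow> (i, y + P * P') \<in> U" if "i < Suc n" "max Y Y' \<le> y" for i y
    using m1[of i y P'] m2[of y P] that by (cases "i = n") (auto simp: mult.commute)
  moreover have "0 < P * P'" using P P' by simp
  ultimately show ?case by blast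
qed auto

section \<open>Counting the representations of a point of a column\<close>

text \<open>
  Each unordered pair of summands is listed once, the lexicographically smaller one first. With this
  order only the first summand can lie in column \<open>0\<close> when the sum lies in a column \<open>x > 0\<close>.
\<close>

definition ordered_reps ::
  "(nat \<times> nat \<Rightarrow> nat \<times> nat \<Rightarrow> bool) \<Rightarrow> (nat \<times> nat) set \<Rightarrow> nat \<times> nat
    \<Rightarrow> ((nat \<times> nat) \<times> (nat \<times> nat)) set" where
  "ordered_reps R U z = {(p, q). p \<in> U \<and> q \<in> U \<and> R p q \<and> p + q = z \<and>
     (fst p < fst q \<or> fst p = fst q \<and> snd p \<le> snd q)}"

definition low_reps ::
  "(nat \<times> nat \<Rightarrow> nat \<times> nat \<Rightarrow> bool) \<Rightarrow> (nat \<times> nat) set \<Rightarrow> nat \<Rightarrow> nat \<times> nat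
    \<Rightarrow> ((nat \<times> nat) \<times> (nat \<times> nat)) set" where
  "low_reps R U Y z = {(p, q) \<in> ordered_reps R U z. fst p = 0 \<and> snd p < Y}"

lemma finite_ordered_reps: "finite (ordered_reps R U z)"
proof (rule finite_subset)
  show "ordered_reps R U z \<subseteq>
      ({..fst z} \<times> {..snd z}) \<times> ({..fst z} \<times> {..snd z})"
    unfolding ordered_reps_def by auto
qed simp

lemma unique_rep_iff_card:
  assumes R: "\<forall>p q. p \<noteq> q \<longrightarrow> R p q"
  shows "(\<exists>!T. T \<in> reps R U z) \<longleftrightarrow> card (ordered_reps R U z) = 1"
proof -
  let ?f = "\<lambda>(p, q). {p, q :: nat \<times> nat}"
  have inj: "inj_on ?f (ordered_reps R U z)"
  proof (rule inj_onI)
    fix t t' assume t: "t \<in> ordered_reps R U z" "t' \<in> ordered_reps R U z" "?f t = ?f t'"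
    obtain p q p' q' where pq: "t = (p, q)" "t' = (p', q')" by (metis surj_pair)
    have "p = p' \<and> q = q' \<or> p = q' \<and> q = p'"
      using t(3) pq by (simp add: doubleton_eq_iff)
    then show "t = t'"
      using t(1,2) unfolding pq ordered_reps_def by (auto simp: prod_eq_iff)
  qed
  have "?f ` ordered_reps R U z = reps R U z"
  proof
    show "?f ` ordered_reps R U z \<subseteq> reps R U z"
      unfolding ordered_reps_def by (auto intro!: repsI simp del: insert_iff)
    show "reps R U z \<subseteq> ?f ` ordered_reps R U z"
    proof
      fix T assume "T \<in> reps R U z"
      then obtain p q where pq: "T = {p, q}" "p \<in> U" "q \<in> U" "R p q" "p + q = z"
        by (rule repsE)
      have R': "R q p" using pq(4) R by metis
      have "(p, q) \<in> ordered_reps R U z \<or> (q, p) \<in> ordered_reps R U z"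
        unfolding ordered_reps_def using pq R' by (auto simp: add.commute)
      moreover have "T = ?f (p, q)" "T = ?f (q, p)" using pq(1) by auto
      ultimately show "T \<in> ?f ` ordered_reps R U z" by blast
    qed
  qed
  then have "card (reps R U z) = card (ordered_reps R U z)" using card_image[OF inj] by simp
  moreover have "(\<exists>!T. T \<in> X) \<longleftrightarrow> card X = 1" for X :: "(nat \<times> nat) set set"
    unfolding card_1_singleton_iff One_nat_def by blast
  ultimately show ?thesis by simp
qed

text \<open>
  The value \<open>b = 0\<close> is left out because \<open>(0, 0)\<close> is never a summand; so the low representations of
  a point refer only to strictly lower points of its column, which makes them usable in a recursion.
\<close>

lemma card_low_reps:
  assumes R: "\<forall>p q. p \<noteq> q \<longrightarrow> R p q" and zero: "(0, 0) \<notin> U" and x: "0 < x" and y: "Y \<le> y"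
  shows "card (low_reps R U Y (x, y)) =
    card {b \<in> {1..<Y}. (0, b) \<in> U \<and> (x, y - b) \<in> U}"
proof -
  let ?I = "{b \<in> {1..<Y}. (0, b) \<in> U \<and> (x, y - b) \<in> U}"
  let ?f = "\<lambda>b. ((0 :: nat, b), (x, y - b))"
  have "low_reps R U Y (x, y) = ?f ` ?I"
  proof
    show "?f ` ?I \<subseteq> low_reps R U Y (x, y)"
      using x y by (auto simp: low_reps_def ordered_reps_def intro!: R[rule_format])
    show "low_reps R U Y (x, y) \<subseteq> ?f ` ?I"
    proof
      fix t assume "t \<in> low_reps R U Y (x, y)"
      then obtain b q where t: "t = ((0, b), q)" "b < Y" "(0, b) \<in> U" "q \<in> U"
          "(0, b) + q = (x, y)"
        unfolding low_reps_def ordered_reps_def by auto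
      have q: "q = (x, y - b)" using t(5) by (cases q) auto
      have "b \<noteq> 0" using zero t(3) by metis
      then show "t \<in> ?f ` ?I" using t q by auto
    qed
  qed
  moreover have "inj_on ?f ?I" by (auto simp: inj_on_def)
  ultimately show ?thesis by (simp add: card_image)
qed

text \<open>
  The injection raises the first summand by \<open>P\<close> if it lies strictly left of the second and has height
  at least \<open>Y\<close>. Otherwise it raises the second summand, which then also lies left of column \<open>x\<close> and
  has height at least \<open>Y\<close>: either both are in the same column and the second is the higher one, or the
  first is below height \<open>Y\<close> and, the representation not being low, outside column \<open>0\<close>. The first
  summand of the image tells which case occurred. The summands of the image are always distinct, so
  the image is admissible for Ulam sets and V-sets alike.
\<close>

lemma card_high_reps_mono:
  assumes R: "\<forall>p q. p \<noteq> q \<longrightarrow> R p q" and x: "0 < x"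
    and per: "\<forall>i<x. \<forall>y\<ge>Y. (i, y) \<in> U \<longleftrightarrow> (i, y + P) \<in> U"
    and y: "2 * Y \<le> y"
  shows "card (ordered_reps R U (x, y) - low_reps R U Y (x, y))
    \<le> card (ordered_reps R U (x, y + P) - low_reps R U Y (x, y + P))"
proof (cases "P = 0")
  case False
  let ?G = "\<lambda>y. ordered_reps R U (x, y) - low_reps R U Y (x, y)"
  let ?f = "\<lambda>((i, a), (j, b)). if i < j \<and> Y \<le> a then ((i, a + P), (j, b)) else ((i, a), (j, b + P))"
  have G: "((i, a), (j, b)) \<in> ?G y \<longleftrightarrow> (i, a) \<in> U \<and> (j, b) \<in> U \<and> R (i, a) (j, b) \<and>
      i + j = x \<and> a + b = y \<and> (i < j \<or> i = j \<and> a \<le> b) \<and> (i = 0 \<longrightarrow> Y \<le> a)" for i a j b y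
    unfolding low_reps_def ordered_reps_def by auto
  have "inj_on ?f (?G y)"
  proof (rule inj_onI)
    fix t t' assume t: "t \<in> ?G y" "t' \<in> ?G y" "?f t = ?f t'"
    obtain i a j b where t1: "t = ((i, a), (j, b))"
      by (cases t; cases "fst t"; cases "snd t") auto
    obtain i' a' j' b' where t2: "t' = ((i', a'), (j', b'))"
      by (cases t'; cases "fst t'"; cases "snd t'") auto
    note tt = t1 t2
    show "t = t'"
      using t(3) t(1,2)[unfolded tt G] unfolding tt
      by (cases "i < j \<and> Y \<le> a"; cases "i' < j' \<and> Y \<le> a'") auto
  qed
  moreover have "?f ` ?G y \<subseteq> ?G (y + P)"
  proof (rule image_subsetI)
    fix t assume t: "t \<in> ?G y"
    obtain i a j b where tt: "t = ((i, a), (j, b))"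
      by (cases t; cases "fst t"; cases "snd t") auto
    have g: "(i, a) \<in> U" "(j, b) \<in> U" "i + j = x" "a + b = y" "i < j \<or> i = j \<and> a \<le> b"
        "i = 0 \<longrightarrow> Y \<le> a"
      using t unfolding tt G by blast+
    show "?f t \<in> ?G (y + P)"
    proof (cases "i < j \<and> Y \<le> a")
      case True
      have "(i, a + P) \<in> U" using per[rule_format, of i a] g True by linarith
      then have "((i, a + P), (j, b)) \<in> ?G (y + P)" unfolding G
        using g True by (auto intro!: R[rule_format])
      then show ?thesis using True tt by simp
    next
      case False
      have "j < x" using g x False by auto
      moreover have "Y \<le> b" using g y False by auto
      ultimately have "(j, b + P) \<in> U" using per[rule_format, of j b] g by blast
      then have "((i, a), (j, b + P)) \<in> ?G (y + P)"
        unfolding G using g \<open>P \<noteq> 0\<close> by (auto intro!: R[rule_format])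
      then show ?thesis using False tt by auto
    qed
  qed
  ultimately show ?thesis
    by (rule card_inj_on_le) (simp add: finite_ordered_reps)
qed simp

section \<open>Periodicity of the columns\<close>

lemma next_column_eventually_periodic:
  assumes R: "\<forall>p q. p \<noteq> q \<longrightarrow> R p q" and zero: "(0, 0) \<notin> U" and S: "finite S"
    and rec: "\<forall>z. z \<notin> S \<longrightarrow> (z \<in> U \<longleftrightarrow> (\<exists>!T. T \<in> reps R U z))"
    and x: "0 < x" and left: "\<forall>i<x. column_eventually_periodic U i"
  shows "column_eventually_periodic U x"
proof -
  obtain P Y where P: "0 < P"
    and per: "\<forall>i<x. \<forall>y\<ge>Y. (i, y) \<in> U \<longleftrightarrow> (i, y + P) \<in> U"
    using common_period[OF left] by blast
  let ?G = "\<lambda>y. ordered_reps R U (x, y) - low_reps R U Y (x, y)"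
  let ?W = "\<lambda>y. low_reps R U Y (x, y)"
  define c where "c y = min 2 (card (?G y))" for y
  have "c y \<le> c (y + P)" if "2 * Y \<le> y" for y
    unfolding c_def by (intro min.mono order_refl card_high_reps_mono[OF R x per that])
  then obtain M where M: "\<And>y. M \<le> y \<Longrightarrow> c (y + P) = c y"
    using bounded_mono_shift_eventually_periodic[of "2 * Y" c P 2] unfolding c_def by auto
  obtain H where H: "\<And>y. H \<le> y \<Longrightarrow> (x, y) \<notin> S"
  proof -
    have "finite (snd ` S)" using S by simp
    then obtain k where k: "\<forall>n\<in>snd ` S. n < k"
      unfolding finite_nat_set_iff_bounded by blast
    then have "(x, y) \<notin> S" if "k \<le> y" for y using that by force
    then show ?thesis using that by blast
  qed
  define N where "N = max (max M H) Y"
  have split: "(x, y) \<in> U \<longleftrightarrow> c y + card (?W y) = 1" if "N \<le> y" for y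
  proof -
    have sub: "?W y \<subseteq> ordered_reps R U (x, y)" unfolding low_reps_def by auto
    have "card (?W y) \<le> card (ordered_reps R U (x, y))"
      using sub finite_ordered_reps by (rule card_mono[rotated])
    then have "card (ordered_reps R U (x, y)) = card (?G y) + card (?W y)"
      using card_Diff_subset[OF finite_subset[OF sub finite_ordered_reps] sub] by simp
    then show ?thesis
      using rec[rule_format, of "(x, y)"] H[of y] that unique_rep_iff_card[OF R, of U "(x, y)"]
      unfolding N_def c_def by auto
  qed
  have "\<exists>p>0. \<exists>M. \<forall>y\<ge>M. ((x, y) \<in> U) = ((x, y + p) \<in> U)"
  proof (rule window_recursion_eventually_periodic[of P N c Y])
    fix y y' assume y: "N \<le> y" "N \<le> y'" and c: "c y = c y'"
      and w: "\<And>i. 1 \<le> i \<Longrightarrow> i \<le> Y \<Longrightarrow> ((x, y - i) \<in> U) = ((x, y' - i) \<in> U)"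
    have "{b \<in> {1..<Y}. (0, b) \<in> U \<and> (x, y - b) \<in> U} =
        {b \<in> {1..<Y}. (0, b) \<in> U \<and> (x, y' - b) \<in> U}"
      using w by auto
    then have "card (?W y) = card (?W y')"
      using card_low_reps[OF R zero x, of Y y] card_low_reps[OF R zero x, of Y y'] y
      unfolding N_def by simp
    then show "((x, y) \<in> U) = ((x, y') \<in> U)" using split y c by simp
  qed (use P M in \<open>auto simp: N_def\<close>)
  then show ?thesis unfolding column_eventually_periodic_def .
qed

theorem theorem5p2:
  fixes S U :: "(nat \<times> nat) set"
  assumes "finite S"
    and "(0, 0) \<notin> S"
    and "ulam_set S U \<or> V_set S U"
    and "column_eventually_periodic U 0"
  shows "\<forall>x. column_eventually_periodic U x"
proof -
  obtain R where gen: "generated R S U" and R: "\<forall>p q. p \<noteq> q \<longrightarrow> R p q"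
    using assms(3) unfolding ulam_set_def V_set_def by blast
  note zero = generated_zero_notin[OF gen assms(2)]
  have rec: "\<forall>z. z \<notin> S \<longrightarrow> (z \<in> U \<longleftrightarrow> (\<exists>!T. T \<in> reps R U z))"
    using generated_iff_unique_rep[OF gen assms(2)] by blast
  have "column_eventually_periodic U x" for x
  proof (induction x rule: less_induct)
    case (less x)
    show ?case
    proof (cases "x = 0")
      case False
      then show ?thesis
        using next_column_eventually_periodic[OF R zero assms(1) rec] less.IH by blast
    qed (use assms(4) in simp)
  qed
  then show ?thesis by blast
qed

end
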